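(* Let $A$ be an idiom and $j\in N(A)$. The following statements hold: (1) $Boy^{\infty}(j)=tp$ if and only if $\{1\}$ is the only cohesive subset of $A_j$. (2) $A_{Boy^{\infty}(j)}$ is the biggest cohesive subset of $A_j$. (3) $Boy^{\infty}(j)=j$ if and only if $A_j$ is cohesive.
   Context: An idiom is a complete lattice $A$ (bottom $0$, top $1$) which is modular and upper-continuous: $a\wedge\bigvee X=\bigvee\{a\wedge x\mid x\in X\}$ for all $a\in A$ and all directed $X\subseteq A$. A nucleus on $A$ is a map $j\colon A\to A$ that is monotone, satisfies $a\le j(a)$, $j(a\wedge b)=j(a)\wedge j(b)$ and $j\circ j=j$. $N(A)$ is the set of all nuclei on $A$ ordered pointwise; it is a frame with bottom $id$ and top $tp$, where $tp(a)=1$ for all $a$. For $j\in N(A)$, $A_j=\{a\in A\mid j(a)=a\}$. For $a,b\in A$ write $a\lessdot b$ if $a\le b$ and for every $y\in A$, $b\wedge y\le a$ implies $y\le a$. A nonempty subset $\mathcal K\subseteq A$ is cohesive if for each $a\in\mathcal K$ there exists $X\subseteq\mathcal K$ such that $a=\bigwedge X$ and $a\lessdot x$ for each $x\in X$. A cohesive subset of $A_j$ is a cohesive subset $\mathcal K$ of $A$ with $\mathcal K\subseteq A_j$. For $a\le b$ the interval $[a,b]$ is $\{x\in A\mid a\le x\le b\}$. Two intervals are similar if they are $[l,l\vee r]$ and $[l\wedge r,r]$ (in some order) for some $l,r\in A$. A basic set is a nonempty set of intervals closed under similarity and under subintervals. A division set is a basic set $\mathcal D$ such that $[a,b],[b,c]\in\mathcal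 D$ implies $[a,c]\in\mathcal D$, and such that for each $a\in A$ and nonempty $X\subseteq[a,1]$, if $[a,x]\in\mathcal D$ for all $x\in X$ then $[a,\bigvee X]\in\mathcal D$. Nuclei correspond bijectively to division sets via $j\mapsto \mathcal D_j=\{[a,b]\mid b\le j(a)\}$, with inverse $\mathcal D\mapsto|\mathcal D|$, $|\mathcal D|(a)=\bigvee\{x\ge a\mid[a,x]\in\mathcal D\}$. For a basic set $\mathcal B$, $Dvs(\mathcal B)$ is the least division set containing $\mathcal B$. For a basic set $\mathcal B$, $Fll(\mathcal B)$ is the set of ($\mathcal B$-full) intervals $[a,b]$ such that for every $a\le x\le b$ there is $a\le y\le b$ with $x\wedge y=a$ and $[x\vee y,b]\in\mathcal B$; it is a basic set. For $j\in N(A)$, $Boy(j)$ (the Boyle derivative of $j$) is the nucleus whose division set is $Dvs(Fll(\mathcal D_j))$. Iterate: $Boy^0(j)=j$, $Boy^{\alpha+1}(j)=Boy(Boy^\alpha(j))$, $Boy^\lambda(j)=\bigvee_{\alpha<\lambda}Boy^\alpha(j)$ (supremum in $N(A)$) for limit $\lambda$. This increasing chain eventually stabilizes; $Boy^\infty(j)$ denotes its stable value. *)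

theory Defs
  imports Main
begin

class idiom = complete_lattice +
  assumes modular: "a \<le> c \<Longrightarrow> sup a (inf b c) = inf (sup a b) c"
    and upper_continuous:
      "X \<noteq> {} \<Longrightarrow> (\<And>x y. x \<in> X \<Longrightarrow> y \<in> X \<Longrightarrow> \<exists>z\<in>X. x \<le> z \<and> y \<le> z)
        \<Longrightarrow> inf a (Sup X) = Sup (inf a ` X)"

definition nucleus :: "('a::idiom \<Rightarrow> 'a) \<Rightarrow> bool" where
  "nucleus j \<longleftrightarrow> mono j \<and> (\<forall>a. a \<le> j a) \<and> (\<forall>a b. j (inf a b) = inf (j a) (j b)) \<and> j \<circ> j = j"

definition tp :: "'a::idiom \<Rightarrow> 'a" where
  "tp = (\<lambda>a. top)"

definition fixpoints :: "('a::idiom \<Rightarrow> 'a) \<Rightarrow> 'a set" where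
  "fixpoints j = {a. j a = a}"

(* The order on functions is the pointwise one, so this is the supremum in the poset of nuclei,
   which in general is not the pointwise supremum. *)
definition nuclei_Sup :: "('a::idiom \<Rightarrow> 'a) set \<Rightarrow> 'a \<Rightarrow> 'a" where
  "nuclei_Sup J = (LEAST k. nucleus k \<and> (\<forall>j\<in>J. j \<le> k))"

definition ess_below :: "'a::idiom \<Rightarrow> 'a \<Rightarrow> bool" where
  "ess_below a b \<longleftrightarrow> a \<le> b \<and> (\<forall>y. inf b y \<le> a \<longrightarrow> y \<le> a)"

definition cohesive :: "'a::idiom set \<Rightarrow> bool" where
  "cohesive K \<longleftrightarrow> K \<noteq> {} \<and> (\<forall>a\<in>K. \<exists>X\<subseteq>K. a = Inf X \<and> (\<forall>x\<in>X. ess_below a x))"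

definition cohesive_in :: "('a::idiom \<Rightarrow> 'a) \<Rightarrow> 'a set \<Rightarrow> bool" where
  "cohesive_in j K \<longleftrightarrow> cohesive K \<and> K \<subseteq> fixpoints j"

(* An interval is represented by its underlying set, which determines the end points
   since it is nonempty. *)
definition intervals :: "'a::idiom set set" where
  "intervals = {{a..b} | a b. a \<le> b}"

definition similar :: "'a::idiom set \<Rightarrow> 'a set \<Rightarrow> bool" where
  "similar I J \<longleftrightarrow> (\<exists>l r. (I = {l..sup l r} \<and> J = {inf l r..r}) \<or> (I = {inf l r..r} \<and> J = {l..sup l r}))"

definition basic_set :: "'a::idiom set set \<Rightarrow> bool" where
  "basic_set B \<longleftrightarrow> B \<noteq> {} \<and> B \<subseteq> intervals
     \<and> (\<forall>I\<in>B. \<forall>J. similar I J \<longrightarrow> J \<in> B)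
     \<and> (\<forall>I\<in>B. \<forall>J\<in>intervals. J \<subseteq> I \<longrightarrow> J \<in> B)"

definition division_set :: "'a::idiom set set \<Rightarrow> bool" where
  "division_set D \<longleftrightarrow> basic_set D
     \<and> (\<forall>a b c. {a..b} \<in> D \<longrightarrow> {b..c} \<in> D \<longrightarrow> {a..c} \<in> D)
     \<and> (\<forall>a X. X \<noteq> {} \<longrightarrow> X \<subseteq> {a..top} \<longrightarrow> (\<forall>x\<in>X. {a..x} \<in> D) \<longrightarrow> {a..Sup X} \<in> D)"

definition div_of_nuc :: "('a::idiom \<Rightarrow> 'a) \<Rightarrow> 'a set set" where
  "div_of_nuc j = {{a..b} | a b. a \<le> b \<and> b \<le> j a}"

definition nuc_of_div :: "'a::idiom set set \<Rightarrow> 'a \<Rightarrow> 'a" where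
  "nuc_of_div D a = Sup {x. a \<le> x \<and> {a..x} \<in> D}"

definition Dvs :: "'a::idiom set set \<Rightarrow> 'a set set" where
  "Dvs B = \<Inter>{D. division_set D \<and> B \<subseteq> D}"

definition Fll :: "'a::idiom set set \<Rightarrow> 'a set set" where
  "Fll B = {{a..b} | a b. a \<le> b
     \<and> (\<forall>x\<in>{a..b}. \<exists>y\<in>{a..b}. inf x y = a \<and> {sup x y..b} \<in> B)}"

definition Boy :: "('a::idiom \<Rightarrow> 'a) \<Rightarrow> 'a \<Rightarrow> 'a" where
  "Boy j = nuc_of_div (Dvs (Fll (div_of_nuc j)))"

definition is_succ_of :: "'i rel \<Rightarrow> 'i \<Rightarrow> 'i \<Rightarrow> bool" where
  "is_succ_of r \<alpha> \<beta> \<longleftrightarrow> \<beta> \<in> underS r \<alpha> \<and> underS r \<alpha> \<subseteq> under r \<beta>"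

(* Ordinals are represented as the elements of a well-order r; the recursion equations
   are Boy_iter_zero, Boy_iter_succ and Boy_iter_lim below. *)
definition Boy_iter :: "'i rel \<Rightarrow> ('a::idiom \<Rightarrow> 'a) \<Rightarrow> 'i \<Rightarrow> 'a \<Rightarrow> 'a" where
  "Boy_iter r j = wo_rel.worec r (\<lambda>f \<alpha>.
     if underS r \<alpha> = {} then j
     else if \<exists>\<beta>. is_succ_of r \<alpha> \<beta> then Boy (f (THE \<beta>. is_succ_of r \<alpha> \<beta>))
     else nuclei_Sup (f ` underS r \<alpha>))"

(* The ordinals below the cardinality of the powerset of the function space suffice
   for the iteration to stabilize, see Boy_infty_stable. *)
abbreviation long_order :: "('a::idiom \<Rightarrow> 'a) set rel" where
  "long_order \<equiv> card_of (UNIV :: ('a \<Rightarrow> 'a) set set)"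

definition Boy_infty :: "('a::idiom \<Rightarrow> 'a) \<Rightarrow> 'a \<Rightarrow> 'a" where
  "Boy_infty j =
     (THE k. \<exists>\<alpha>. k = Boy_iter (long_order :: ('a \<Rightarrow> 'a) set rel) j \<alpha> \<and> Boy k = k)"


subsection \<open>Well-definedness\<close>

lemma nucleusD:
  assumes "nucleus j"
  shows "a \<le> b \<Longrightarrow> j a \<le> j b" "a \<le> j a" "j (inf a b) = inf (j a) (j b)" "j (j a) = j a"
  using assms unfolding nucleus_def by (auto dest: monoD simp: fun_eq_iff)

lemma nuclei_Sup_is_lub:
  fixes J :: "('a::idiom \<Rightarrow> 'a) set"
  shows "nucleus (nuclei_Sup J)"
    and "j \<in> J \<Longrightarrow> j \<le> nuclei_Sup J"
    and "nucleus k \<Longrightarrow> (\<And>j. j \<in> J \<Longrightarrow> j \<le> k) \<Longrightarrow> nuclei_Sup J \<le> k"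
proof -
  define S where "S = {k. nucleus k \<and> (\<forall>j\<in>J. j \<le> k)}"
  define m where "m a = (INF k\<in>S. k a)" for a
  have N: "nucleus k" if "k \<in> S" for k using that by (simp add: S_def)
  have le: "m a \<le> k a" if "k \<in> S" for k a using that by (auto simp: m_def intro: INF_lower)
  have mono: "m a \<le> m b" if "a \<le> b" for a b
    unfolding m_def using that N by (intro INF_mono) (blast intro: nucleusD)
  have infl: "a \<le> m a" for a
    unfolding m_def using N by (intro INF_greatest) (blast intro: nucleusD)
  have meet: "m (inf a b) = inf (m a) (m b)" for a b
  proof (rule antisym)
    show "m (inf a b) \<le> inf (m a) (m b)" by (simp add: mono)
    show "inf (m a) (m b) \<le> m (inf a b)" unfolding m_def[of "inf a b"]
      using N le by (intro INF_greatest) (simp add: nucleusD(3) le_infI1 le_infI2)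
  qed
  have idem: "m (m a) = m a" for a
  proof (rule antisym)
    show "m (m a) \<le> m a" unfolding m_def[of a]
    proof (intro INF_greatest)
      fix k assume k: "k \<in> S"
      have "m (m a) \<le> k (m a)" by (rule le[OF k])
      also have "\<dots> \<le> k (k a)" by (rule nucleusD(1)[OF N[OF k] le[OF k]])
      finally have "m (m a) \<le> k a" by (simp add: nucleusD(4) N k)
      then show "m (INF k\<in>S. k a) \<le> k a" by (simp add: m_def)
    qed
  qed (rule infl)
  have nm: "nucleus m"
    unfolding nucleus_def using mono infl meet idem by (auto intro: monoI simp: fun_eq_iff)
  have um: "\<forall>j\<in>J. j \<le> m"
    unfolding m_def le_fun_def by (auto intro!: INF_greatest simp: S_def le_fun_def)
  have lm: "m \<le> k" if "nucleus k \<and> (\<forall>j\<in>J. j \<le> k)" for k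
    using that le by (auto simp: S_def le_fun_def)
  have eq: "nuclei_Sup J = m"
    unfolding nuclei_Sup_def by (rule Least_equality) (use nm um lm in auto)
  show "nucleus (nuclei_Sup J)" "j \<in> J \<Longrightarrow> j \<le> nuclei_Sup J"
    "nucleus k \<Longrightarrow> (\<And>j. j \<in> J \<Longrightarrow> j \<le> k) \<Longrightarrow> nuclei_Sup J \<le> k"
    using nm um lm by (auto simp: eq)
qed

lemma Icc_in_intervals: "{a..b} \<in> intervals \<longleftrightarrow> a \<le> (b::'a::idiom)"
  unfolding intervals_def by (auto simp: Icc_eq_Icc)

lemma basic_setD:
  assumes "basic_set B"
  shows "B \<noteq> {}" "B \<subseteq> intervals" "I \<in> B \<Longrightarrow> similar I J \<Longrightarrow> J \<in> B"
    "I \<in> B \<Longrightarrow> J \<in> intervals \<Longrightarrow> J \<subseteq> I \<Longrightarrow> J \<in> B"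
proof -
  note * = assms[unfolded basic_set_def]
  show "B \<noteq> {}" by (rule *[THEN conjunct1])
  show "B \<subseteq> intervals" by (rule *[THEN conjunct2, THEN conjunct1])
  show "I \<in> B \<Longrightarrow> similar I J \<Longrightarrow> J \<in> B"
    by (rule *[THEN conjunct2, THEN conjunct2, THEN conjunct1, rule_format])
  show "I \<in> B \<Longrightarrow> J \<in> intervals \<Longrightarrow> J \<subseteq> I \<Longrightarrow> J \<in> B"
    by (rule *[THEN conjunct2, THEN conjunct2, THEN conjunct2, rule_format])
qed

lemma basic_set_sub:
  assumes "basic_set B" "{a..b} \<in> B" "a \<le> c" "c \<le> d" "d \<le> b"
  shows "{c..d} \<in> B"
  by (rule basic_setD(4)[OF assms(1,2)]) (use assms(3-) in \<open>auto simp: Icc_in_intervals\<close>)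

lemma basic_set_down:
  assumes "basic_set B" "{l..sup l r} \<in> B" shows "{inf l r..r} \<in> B"
  by (rule basic_setD(3)[OF assms]) (auto simp: similar_def)

lemma basic_set_up:
  assumes "basic_set B" "{inf l r..r} \<in> B" shows "{l..sup l r} \<in> B"
  by (rule basic_setD(3)[OF assms]) (auto simp: similar_def)

lemma basic_set_trivial:
  assumes "basic_set B" shows "{a..a} \<in> B"
proof -
  obtain I where I: "I \<in> B" using basic_setD(1)[OF assms] by auto
  then have "I \<in> intervals" using basic_setD(2)[OF assms] by (rule rev_subsetD)
  then obtain c d where cd: "{c..d} \<in> B" "c \<le> d"
    using I unfolding intervals_def by auto
  have cc: "{c..c} \<in> B" using basic_set_sub[OF assms cd(1), of c c] cd(2) by simp
  have "{inf a c..inf a c} \<in> B"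
    using basic_set_down[OF assms, of c "inf a c"] cc by (simp add: inf_commute sup_absorb1 inf_absorb2)
  then show ?thesis using basic_set_up[OF assms, of a "inf a c"] by (simp add: sup_absorb1 inf_absorb2)
qed

lemma division_setD:
  assumes "division_set D"
  shows "basic_set D" "{a..b} \<in> D \<Longrightarrow> {b..c} \<in> D \<Longrightarrow> {a..c} \<in> D"
    "X \<noteq> {} \<Longrightarrow> X \<subseteq> {a..top} \<Longrightarrow> (\<And>x. x \<in> X \<Longrightarrow> {a..x} \<in> D) \<Longrightarrow> {a..Sup X} \<in> D"
proof -
  note * = assms[unfolded division_set_def]
  show "basic_set D" by (rule *[THEN conjunct1])
  show "{a..b} \<in> D \<Longrightarrow> {b..c} \<in> D \<Longrightarrow> {a..c} \<in> D"
    by (rule *[THEN conjunct2, THEN conjunct1, rule_format])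
  show "X \<noteq> {} \<Longrightarrow> X \<subseteq> {a..top} \<Longrightarrow> (\<And>x. x \<in> X \<Longrightarrow> {a..x} \<in> D) \<Longrightarrow> {a..Sup X} \<in> D"
    by (rule *[THEN conjunct2, THEN conjunct2, rule_format])
qed

lemma Dvs_iff: "I \<in> Dvs B \<longleftrightarrow> (\<forall>D. division_set D \<longrightarrow> B \<subseteq> D \<longrightarrow> I \<in> D)"
  unfolding Dvs_def by auto

lemma division_set_Dvs: "division_set (Dvs B)"
  if "B \<subseteq> intervals" for B :: "'a::idiom set set"
proof -
  have I: "division_set (intervals :: 'a set set)"
    unfolding division_set_def basic_set_def
  proof (intro conjI allI impI ballI)
    show "intervals \<noteq> ({} :: 'a set set)" using Icc_in_intervals[of bot bot] by auto
    show "J \<in> intervals" if "similar I J" for I J :: "'a set"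
      using that unfolding similar_def by (auto simp: Icc_in_intervals)
  qed (auto simp: Icc_in_intervals intro: Sup_upper2)
  show ?thesis
    unfolding division_set_def basic_set_def
  proof (intro conjI allI impI ballI)
    have "{bot..bot} \<in> Dvs B"
      unfolding Dvs_iff by (blast intro: division_setD(1) basic_set_trivial)
    then show "Dvs B \<noteq> {}" by auto
    show "Dvs B \<subseteq> intervals" using I that by (auto simp: Dvs_iff)
    show "J \<in> Dvs B" if "I \<in> Dvs B" "similar I J" for I J
      unfolding Dvs_iff
    proof (intro allI impI)
      fix D assume D: "division_set D" "B \<subseteq> D"
      then have "I \<in> D" using that(1) by (simp add: Dvs_iff)
      then show "J \<in> D" using that(2) by (rule basic_setD(3)[OF division_setD(1)[OF D(1)]])
    qed
    show "J \<in> Dvs B" if "I \<in> Dvs B" "J \<in> intervals" "J \<subseteq> I" for I J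
      unfolding Dvs_iff
    proof (intro allI impI)
      fix D assume D: "division_set D" "B \<subseteq> D"
      then have "I \<in> D" using that(1) by (simp add: Dvs_iff)
      then show "J \<in> D" using that(2,3) by (rule basic_setD(4)[OF division_setD(1)[OF D(1)]])
    qed
    show "{a..c} \<in> Dvs B" if "{a..b} \<in> Dvs B" "{b..c} \<in> Dvs B" for a b c
      unfolding Dvs_iff
    proof (intro allI impI)
      fix D assume D: "division_set D" "B \<subseteq> D"
      show "{a..c} \<in> D"
        by (rule division_setD(2)[OF D(1), of a b c]) (use D that in \<open>simp_all add: Dvs_iff\<close>)
    qed
    show "{a..Sup X} \<in> Dvs B" if "X \<noteq> {}" "X \<subseteq> {a..top}" "\<forall>x\<in>X. {a..x} \<in> Dvs B" for a X
      unfolding Dvs_iff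
    proof (intro allI impI)
      fix D assume D: "division_set D" "B \<subseteq> D"
      have "{a..x} \<in> D" if "x \<in> X" for x
        using bspec[OF \<open>\<forall>x\<in>X. {a..x} \<in> Dvs B\<close> that] D by (simp add: Dvs_iff)
      then show "{a..Sup X} \<in> D" by (rule division_setD(3)[OF D(1) that(1,2)])
    qed
  qed
qed

lemma Dvs_least: "B \<subseteq> Dvs B" "division_set D \<Longrightarrow> B \<subseteq> D \<Longrightarrow> Dvs B \<subseteq> D"
  unfolding Dvs_def by auto

lemma nuc_of_div_Icc:
  assumes "division_set D"
  shows "a \<le> nuc_of_div D a" "{a..nuc_of_div D a} \<in> D"
    "a \<le> b \<Longrightarrow> {a..b} \<in> D \<longleftrightarrow> b \<le> nuc_of_div D a"
proof -
  have B: "basic_set D" using assms by (rule division_setD)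
  have a: "a \<in> {x. a \<le> x \<and> {a..x} \<in> D}" using basic_set_trivial[OF B] by simp
  then show le: "a \<le> nuc_of_div D a" unfolding nuc_of_div_def by (rule Sup_upper)
  show *: "{a..nuc_of_div D a} \<in> D"
    unfolding nuc_of_div_def by (rule division_setD(3)[OF assms]) (use a in auto)
  show "{a..b} \<in> D \<longleftrightarrow> b \<le> nuc_of_div D a" if "a \<le> b"
  proof
    show "b \<le> nuc_of_div D a" if "{a..b} \<in> D"
      unfolding nuc_of_div_def using that \<open>a \<le> b\<close> by (auto intro: Sup_upper)
    show "{a..b} \<in> D" if "b \<le> nuc_of_div D a"
      by (rule basic_set_sub[OF B * order_refl \<open>a \<le> b\<close> that])
  qed
qed

lemma nucleus_nuc_of_div:
  assumes D: "division_set D"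
  shows "nucleus (nuc_of_div D)"
proof -
  let ?j = "nuc_of_div D"
  note J = nuc_of_div_Icc[OF D]
  have B: "basic_set D" using D by (rule division_setD)
  have T: "{a..c} \<in> D" if "{a..b} \<in> D" "{b..c} \<in> D" for a b c
    using that by (rule division_setD(2)[OF D])
  have mono: "?j a \<le> ?j b" if "a \<le> b" for a b
  proof -
    have "{sup a (inf b (?j a))..?j a} \<in> D"
      using basic_set_sub[OF B J(2), of a "sup a (inf b (?j a))" "?j a"] J(1)[of a] by simp
    then have "{inf b (?j a)..?j a} \<in> D"
      using that J(1)[of a] by (simp add: sup_absorb2)
    then have "{b..sup b (?j a)} \<in> D" by (rule basic_set_up[OF B])
    then have "sup b (?j a) \<le> ?j b" using J(3)[of b "sup b (?j a)"] by simp
    then show ?thesis by simp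
  qed
  have idem: "?j (?j a) = ?j a" for a
  proof (rule antisym)
    have "{a..?j (?j a)} \<in> D" by (rule T[OF J(2) J(2)])
    then show "?j (?j a) \<le> ?j a"
      using J(3)[of a "?j (?j a)"] J(1)[of a] J(1)[of "?j a"] by (meson order_trans)
  qed (rule J(1))
  have meet: "?j (inf a b) = inf (?j a) (?j b)" for a b
  proof (rule antisym)
    show "?j (inf a b) \<le> inf (?j a) (?j b)" by (simp add: mono)
    let ?c = "inf (?j a) (?j b)"
    have "{a..sup a ?c} \<in> D" using J(3)[of a "sup a ?c"] J(1)[of a] by (simp add: le_infI1)
    then have 1: "{inf a ?c..?c} \<in> D" by (rule basic_set_down[OF B])
    have "{b..sup b (inf a ?c)} \<in> D"
      using J(3)[of b "sup b (inf a ?c)"] J(1)[of b] by (simp add: le_infI2)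
    then have "{inf b (inf a ?c)..inf a ?c} \<in> D" by (rule basic_set_down[OF B])
    moreover have "inf b (inf a ?c) = inf a b"
      using J(1)[of a] J(1)[of b] by (intro antisym) (auto intro: le_infI1 le_infI2)
    ultimately have "{inf a b..inf a ?c} \<in> D" by simp
    from T[OF this 1] show "?c \<le> ?j (inf a b)"
      using J(3)[of "inf a b" ?c] J(1)[of a] J(1)[of b] by (meson inf_mono)
  qed
  show ?thesis
    unfolding nucleus_def using mono idem meet J(1) by (auto intro: monoI simp: fun_eq_iff)
qed

lemma div_of_nuc_of_div:
  assumes D: "division_set D"
  shows "div_of_nuc (nuc_of_div D) = D"
proof (intro set_eqI iffI)
  fix I assume "I \<in> div_of_nuc (nuc_of_div D)"
  then show "I \<in> D" unfolding div_of_nuc_def using nuc_of_div_Icc(3)[OF D] by auto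
next
  fix I assume I: "I \<in> D"
  then obtain a b where "I = {a..b}" "a \<le> b"
    using basic_setD(2)[OF division_setD(1)[OF D]] unfolding intervals_def by fast
  then show "I \<in> div_of_nuc (nuc_of_div D)"
    unfolding div_of_nuc_def using nuc_of_div_Icc(3)[OF D, of a b] I by auto
qed

lemma Fll_subset: "Fll B \<subseteq> intervals"
  unfolding Fll_def intervals_def by blast

lemma nucleus_Boy: "nucleus (Boy j)"
  unfolding Boy_def by (intro nucleus_nuc_of_div division_set_Dvs Fll_subset)

lemma div_of_Boy: "div_of_nuc (Boy j) = Dvs (Fll (div_of_nuc j))"
  unfolding Boy_def by (intro div_of_nuc_of_div division_set_Dvs Fll_subset)

lemma Boy_ge:
  assumes j: "nucleus j" shows "j \<le> Boy j"
proof (rule le_funI)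
  fix a
  have "{a..j a} \<in> Fll (div_of_nuc j)"
    unfolding Fll_def
  proof (intro CollectI exI conjI ballI)
    show "{a..j a} = {a..j a}" ..
    show "a \<le> j a" by (rule nucleusD(2)[OF j])
    fix x assume x: "x \<in> {a..j a}"
    have "{x..j a} \<in> div_of_nuc j"
      unfolding div_of_nuc_def using x nucleusD(1)[OF j, of a x] by auto
    then show "\<exists>y\<in>{a..j a}. inf x y = a \<and> {sup x y..j a} \<in> div_of_nuc j"
      using x nucleusD(2)[OF j, of a] by (intro bexI[of _ a]) (auto simp: sup_absorb1 inf_absorb2)
  qed
  then have "{a..j a} \<in> Dvs (Fll (div_of_nuc j))" using Dvs_least(1) by blast
  then show "j a \<le> Boy j a"
    unfolding Boy_def
    by (simp add: nuc_of_div_Icc(3)[OF division_set_Dvs[OF Fll_subset]] nucleusD(2)[OF j])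
qed

context
  fixes r :: "'i rel" and j :: "'a::idiom \<Rightarrow> 'a"
  assumes r: "Well_order r"
begin

interpretation wo: wo_rel r using r by (simp add: wo_rel_def)

lemma succ_unique:
  assumes "is_succ_of r \<alpha> \<beta>" "is_succ_of r \<alpha> \<gamma>" shows "\<gamma> = \<beta>"
proof -
  have "(\<beta>, \<gamma>) \<in> r" "(\<gamma>, \<beta>) \<in> r" using assms unfolding is_succ_of_def under_def by blast+
  then show ?thesis using wo.ANTISYM by (auto dest: antisymD)
qed

lemma Boy_iter_unfold:
  "Boy_iter r j \<alpha> =
    (if underS r \<alpha> = {} then j
     else if \<exists>\<beta>. is_succ_of r \<alpha> \<beta> then Boy (Boy_iter r j (THE \<beta>. is_succ_of r \<alpha> \<beta>))
     else nuclei_Sup (Boy_iter r j ` underS r \<alpha>))"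
proof -
  let ?H = "\<lambda>f \<alpha>. if underS r \<alpha> = {} then j
     else if \<exists>\<beta>. is_succ_of r \<alpha> \<beta> then Boy (f (THE \<beta>. is_succ_of r \<alpha> \<beta>))
     else nuclei_Sup (f ` underS r \<alpha>)"
  have "wo.adm_wo ?H"
    unfolding wo.adm_wo_def
  proof (intro allI impI)
    fix f g :: "'i \<Rightarrow> 'a \<Rightarrow> 'a" and x assume eq: "\<forall>y\<in>underS r x. f y = g y"
    have "f (THE \<beta>. is_succ_of r x \<beta>) = g (THE \<beta>. is_succ_of r x \<beta>)" if s: "is_succ_of r x \<beta>" for \<beta>
    proof -
      have "(THE \<beta>. is_succ_of r x \<beta>) = \<beta>" using s succ_unique[OF s] by (rule the_equality)
      then show ?thesis using s eq by (simp add: is_succ_of_def)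
    qed
    moreover have "f ` underS r x = g ` underS r x" using eq by (simp cong: image_cong)
    ultimately show "?H f x = ?H g x" by auto
  qed
  from wo.worec_fixpoint[OF this] show ?thesis
    unfolding Boy_iter_def by (rule fun_cong)
qed

lemma Boy_iter_zero: "underS r \<alpha> = {} \<Longrightarrow> Boy_iter r j \<alpha> = j"
  by (simp add: Boy_iter_unfold)

lemma Boy_iter_succ: 
  assumes "is_succ_of r \<alpha> \<beta>" shows "Boy_iter r j \<alpha> = Boy (Boy_iter r j \<beta>)"
proof -
  have "(THE \<beta>. is_succ_of r \<alpha> \<beta>) = \<beta>" using assms succ_unique[OF assms] by (rule the_equality)
  then show ?thesis using assms Boy_iter_unfold[of \<alpha>] by (auto simp: is_succ_of_def)
qed

lemma Boy_iter_lim: 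
  assumes "underS r \<alpha> \<noteq> {}" "\<nexists>\<beta>. is_succ_of r \<alpha> \<beta>"
  shows "Boy_iter r j \<alpha> = nuclei_Sup (Boy_iter r j ` underS r \<alpha>)"
  using assms by (subst Boy_iter_unfold) (simp only: if_False)

context
  assumes j: "nucleus j"
begin

lemma nucleus_Boy_iter: "nucleus (Boy_iter r j \<alpha>)"
  by (subst Boy_iter_unfold) (simp add: j nucleus_Boy nuclei_Sup_is_lub(1))

lemma Boy_Boy_iter_le: "\<alpha> \<in> underS r \<beta> \<Longrightarrow> Boy (Boy_iter r j \<alpha>) \<le> Boy_iter r j \<beta>"
proof (induction \<beta> arbitrary: \<alpha> rule: wo.well_order_induct)
  case (1 \<beta>)
  have IH: "Boy (Boy_iter r j \<alpha>) \<le> Boy_iter r j \<gamma>" if "\<gamma> \<in> underS r \<beta>" "\<alpha> \<in> underS r \<gamma>" for \<alpha> \<gamma>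
    using 1(1) that unfolding underS_def by blast
  show ?case
  proof (cases "\<exists>\<gamma>. is_succ_of r \<beta> \<gamma>")
    case True
    then obtain \<gamma> where g: "is_succ_of r \<beta> \<gamma>" by blast
    show ?thesis
    proof (cases "\<alpha> = \<gamma>")
      case True then show ?thesis using Boy_iter_succ[OF g] by simp
    next
      case False
      then have "\<alpha> \<in> underS r \<gamma>" using g 1(2) unfolding is_succ_of_def underS_def under_def by blast
      then have "Boy (Boy_iter r j \<alpha>) \<le> Boy_iter r j \<gamma>" using IH g unfolding is_succ_of_def by blast
      also have "\<dots> \<le> Boy (Boy_iter r j \<gamma>)" by (rule Boy_ge[OF nucleus_Boy_iter])
      finally show ?thesis using Boy_iter_succ[OF g] by simp
    qed
  next
    case False
    then obtain \<gamma> where g: "\<gamma> \<in> underS r \<beta>" "(\<gamma>, \<alpha>) \<notin> r"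
      using 1(2) unfolding is_succ_of_def under_def by blast
    have "\<alpha> \<in> Field r" "\<gamma> \<in> Field r" using g(1) 1(2) unfolding underS_def Field_def by blast+
    then have ag: "\<alpha> \<in> underS r \<gamma>" using g(2) wo.TOTALS wo.REFL unfolding underS_def refl_on_def by blast
    have "Boy (Boy_iter r j \<alpha>) \<le> Boy_iter r j \<gamma>" by (rule IH[OF g(1) ag])
    also have "\<dots> \<le> nuclei_Sup (Boy_iter r j ` underS r \<beta>)"
      using g(1) by (intro nuclei_Sup_is_lub(2)) blast
    also have "\<dots> = Boy_iter r j \<beta>" using False 1(2) by (intro Boy_iter_lim[symmetric]) auto
    finally show ?thesis .
  qed
qed

lemma Boy_iter_constant:
  assumes "Boy (Boy_iter r j \<alpha>) = Boy_iter r j \<alpha>" "\<alpha> \<in> underS r \<beta>"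
  shows "Boy_iter r j \<beta> = Boy_iter r j \<alpha>"
  using assms(2)
proof (induction \<beta> rule: wo.well_order_induct)
  case (1 \<beta>)
  let ?F = "Boy_iter r j"
  have up: "?F \<gamma> \<le> ?F \<alpha>" if g: "\<gamma> \<in> underS r \<beta>" for \<gamma>
  proof -
    have "\<alpha> \<in> Field r" "\<gamma> \<in> Field r" using g 1(2) unfolding underS_def Field_def by blast+
    then consider "\<gamma> = \<alpha>" | "\<gamma> \<in> underS r \<alpha>" | "\<alpha> \<in> underS r \<gamma>"
      using wo.TOTALS unfolding underS_def by blast
    then show ?thesis
    proof cases
      case 2
      have "?F \<gamma> \<le> Boy (?F \<gamma>)" by (rule Boy_ge[OF nucleus_Boy_iter])
      also have "\<dots> \<le> ?F \<alpha>" by (rule Boy_Boy_iter_le[OF 2])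
      finally show ?thesis .
    next
      case 3
      then show ?thesis using 1(1) g unfolding underS_def by auto
    qed simp
  qed
  show ?case
  proof (rule antisym)
    show "?F \<alpha> \<le> ?F \<beta>" using Boy_Boy_iter_le[OF 1(2)] assms(1) by simp
    show "?F \<beta> \<le> ?F \<alpha>"
    proof (cases "\<exists>\<gamma>. is_succ_of r \<beta> \<gamma>")
      case True
      then obtain \<gamma> where g: "is_succ_of r \<beta> \<gamma>" by blast
      then have gu: "\<gamma> \<in> underS r \<beta>" by (simp add: is_succ_of_def)
      have "\<gamma> = \<alpha> \<or> \<alpha> \<in> underS r \<gamma>" using g 1(2) unfolding is_succ_of_def underS_def under_def by blast
      then have "?F \<gamma> = ?F \<alpha>" using 1(1) gu unfolding underS_def by blast
      then show ?thesis using Boy_iter_succ[OF g] assms(1) by simp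
    next
      case False
      then have "?F \<beta> = nuclei_Sup (?F ` underS r \<beta>)" using 1(2) by (intro Boy_iter_lim) auto
      also have "\<dots> \<le> ?F \<alpha>" using up by (intro nuclei_Sup_is_lub(3) nucleus_Boy_iter) auto
      finally show ?thesis .
    qed
  qed
qed

end

end

lemma Boy_infty_stable:
  fixes j :: "'a::idiom \<Rightarrow> 'a"
  defines "r \<equiv> (long_order :: ('a \<Rightarrow> 'a) set rel)"
  assumes j: "nucleus j"
  shows "\<exists>\<alpha>. Boy_infty j = Boy_iter r j \<alpha>"
    and "Boy (Boy_infty j) = Boy_infty j"
    and "\<exists>\<alpha>. \<forall>\<beta>. (\<alpha>, \<beta>) \<in> r \<longrightarrow> Boy_iter r j \<beta> = Boy_infty j"
  unfolding r_def
proof -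
  let ?r = "long_order :: ('a \<Rightarrow> 'a) set rel" and ?F = "Boy_iter (long_order :: ('a \<Rightarrow> 'a) set rel) j"
  have r: "Well_order ?r" by (rule card_of_Well_order)
  have tot: "\<alpha> = \<beta> \<or> \<alpha> \<in> underS ?r \<beta> \<or> \<beta> \<in> underS ?r \<alpha>" for \<alpha> \<beta>
    using wo_rel.TOTALS[of ?r] r unfolding underS_def wo_rel_def by (auto simp: Field_card_of)
  have "\<exists>\<alpha>. Boy (?F \<alpha>) = ?F \<alpha>"
  proof (rule ccontr)
    assume no: "\<nexists>\<alpha>. Boy (?F \<alpha>) = ?F \<alpha>"
    have "?F \<alpha> \<noteq> ?F \<beta>" if "\<alpha> \<in> underS ?r \<beta>" for \<alpha> \<beta>
      using Boy_Boy_iter_le[OF r j that] Boy_ge[OF nucleus_Boy_iter[OF r j], of \<alpha>] no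
      by (metis antisym)
    then have "inj ?F" using tot by (metis injI)
    then have "\<exists>g. surj (g :: ('a \<Rightarrow> 'a) \<Rightarrow> ('a \<Rightarrow> 'a) set)" using inj_imp_surj_inv by blast
    then show False using Cantors_theorem[of UNIV] by (metis Pow_UNIV)
  qed
  then obtain \<alpha> where a: "Boy (?F \<alpha>) = ?F \<alpha>" by blast
  have u: "?F \<beta> = ?F \<alpha>" if "Boy (?F \<beta>) = ?F \<beta>" for \<beta>
    using tot[of \<alpha> \<beta>] Boy_iter_constant[OF r j] a that by metis
  have eq: "Boy_infty j = ?F \<alpha>"
    unfolding Boy_infty_def
  proof (rule the_equality)
    show "\<exists>\<beta>. ?F \<alpha> = ?F \<beta> \<and> Boy (?F \<alpha>) = ?F \<alpha>" by (rule exI[of _ \<alpha>]) (rule conjI[OF refl a])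
    fix k assume "\<exists>\<beta>. k = ?F \<beta> \<and> Boy k = k"
    then show "k = ?F \<alpha>" using u by blast
  qed
  have "?F \<beta> = Boy_infty j" if "(\<alpha>, \<beta>) \<in> ?r" for \<beta>
  proof (cases "\<beta> = \<alpha>")
    case False
    then have "\<alpha> \<in> underS ?r \<beta>" using that by (simp add: underS_def)
    then show ?thesis unfolding eq by (rule Boy_iter_constant[OF r j a])
  qed (simp add: eq)
  then show "\<exists>\<alpha>. \<forall>\<beta>. (\<alpha>, \<beta>) \<in> ?r \<longrightarrow> ?F \<beta> = Boy_infty j" by blast
  show "\<exists>\<alpha>. Boy_infty j = ?F \<alpha>" using eq by blast
  show "Boy (Boy_infty j) = Boy_infty j" unfolding eq by (rule a)
qed

end

theory Submission
  imports Defs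
begin

text \<open>
  Everything follows from two facts about a nucleus \<open>k\<close>, whose fixed set is \<open>A\<^sub>k\<close>.

  \<^item> \<^emph>\<open>If \<open>Boy k = k\<close> then \<open>A\<^sub>k\<close> is cohesive\<close> (\<open>cohesive_fixpoints_of_Boy_fixed\<close>). For \<open>a \<in> A\<^sub>k\<close>, let
    \<open>b\<close> be the meet of all \<open>x \<in> A\<^sub>k\<close> with \<open>a \<lessdot> x\<close>. The interval \<open>[a,b]\<close> is full: for \<open>x \<in> [a,b]\<close>
    choose \<open>y\<close> maximal with \<open>x \<sqinter> y = a\<close>. As in module theory, the maximality makes \<open>x \<squnion> y\<close>
    essential over \<open>a\<close>, hence \<open>k (x \<squnion> y)\<close> is one of the elements whose meet is \<open>b\<close>. Fullness and
    \<open>Boy k = k\<close> give \<open>b \<le> k a = a\<close>.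

  \<^item> \<^emph>\<open>A cohesive \<open>K \<subseteq> A\<^sub>k\<close> lies in the fixed set of \<open>Boy k\<close>\<close> (\<open>cohesive_fixed_by_Boy\<close>). If \<open>c \<in> K\<close> is
    the meet of a family of \<open>x \<in> K\<close> with \<open>c \<lessdot> x\<close>, then a full interval \<open>[c,y]\<close> must be trivial:
    \<open>x \<sqinter> y\<close> is essential over \<open>c\<close>, so its only relative complement is \<open>c\<close>, which leaves
    \<open>y \<le> k (x \<sqinter> y) \<le> x\<close> for every \<open>x\<close> of the family.

  The second fact needs a way from \<open>Fll\<close> to the division set that it generates. For a basic set \<open>F\<close>,
  an interval \<open>[a,b]\<close> in \<open>Dvs F\<close> has above each \<open>x \<in> [a,b]\<close> other than \<open>b\<close> a nontrivial interval
  \<open>[x,y]\<close> of \<open>F\<close> with \<open>y \<le> b\<close>, because the intervals with this property already form a division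
  set (\<open>division_set_step_dense\<close>). Consequently the nucleus of \<open>Dvs F\<close> fixes every element that starts
  no nontrivial interval of \<open>F\<close>. Applied to a union of division sets, the same principle shows that
  the supremum of a family of nuclei fixes what all of them fix, which is the limit step.

  By transfinite induction a cohesive subset of \<open>A\<^sub>j\<close> is therefore fixed by all the iterated
  derivatives, including the stable one, whose own fixed set is cohesive by the first fact. So that
  set is the biggest cohesive subset, and the two equivalences follow because a nucleus is
  determined by its fixed set.
\<close>

section \<open>Relative complements in an idiom\<close>

text \<open>
  This is where upper continuity enters: the elements meeting \<open>x\<close> in \<open>a\<close> are closed under suprema
  of chains, so Zorn's lemma applies.
\<close>

lemma maximal_relative_complement:
  fixes a b x :: "'a::idiom"
  assumes "a \<le> x" "a \<le> b"
  obtains y where "a \<le> y" "y \<le> b" "inf x y = a"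
    "\<And>z. y \<le> z \<Longrightarrow> z \<le> b \<Longrightarrow> inf x z = a \<Longrightarrow> z = y"
proof -
  define S where "S = {y. a \<le> y \<and> y \<le> b \<and> inf x y = a}"
  have "\<exists>m\<in>S. \<forall>y\<in>S. m \<le> y \<longrightarrow> y = m"
  proof (rule predicate_Zorn)
    show "partial_order_on S (relation_of (\<le>) S)"
      by (rule partial_order_on_relation_ofI) auto
    fix C assume C: "C \<in> Chains (relation_of (\<le>) S)"
    have CS: "C \<subseteq> S" and ch: "\<And>y z. y \<in> C \<Longrightarrow> z \<in> C \<Longrightarrow> y \<le> z \<or> z \<le> y"
      using C by (auto simp: Chains_def relation_of_def)
    show "\<exists>u\<in>S. \<forall>y\<in>C. y \<le> u"
    proof (cases "C = {}")
      case True
      have "a \<in> S" using assms by (simp add: S_def inf_absorb2)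
      then show ?thesis using True by blast
    next
      case False
      have "inf x (Sup C) = Sup (inf x ` C)"
        by (rule upper_continuous[OF False]) (use ch in blast)
      also have "inf x ` C = {a}" using CS False by (force simp: S_def)
      finally have "inf x (Sup C) = a" by simp
      moreover have "a \<le> Sup C" using CS False by (auto simp: S_def intro: Sup_upper2)
      moreover have "Sup C \<le> b" using CS by (auto simp: S_def intro: Sup_least)
      ultimately show ?thesis by (auto simp: S_def intro: Sup_upper)
    qed
  qed
  then obtain m where "m \<in> S" "\<And>y. y \<in> S \<Longrightarrow> m \<le> y \<Longrightarrow> y = m" by blast
  then show ?thesis by (intro that[of m]) (auto simp: S_def)
qed

text \<open>
  By modularity, an element \<open>z\<close> witnessing that \<open>sup x y\<close> is not essential over \<open>a\<close> could be added
  to \<open>y\<close> without enlarging its meet with \<open>x\<close>.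
\<close>

lemma ess_below_sup_maximal_complement:
  fixes a x y :: "'a::idiom"
  assumes "a \<le> x" "a \<le> y" "inf x y = a"
    and max: "\<And>z. y \<le> z \<Longrightarrow> inf x z = a \<Longrightarrow> z = y"
  shows "ess_below a (sup x y)"
  unfolding ess_below_def
proof (intro conjI allI impI)
  show "a \<le> sup x y" using assms(1) by (rule le_supI1)
  fix z assume z: "inf (sup x y) z \<le> a"
  have "inf x (sup y z) = inf x (inf (sup y z) (sup x y))"
    by (intro antisym) (auto intro: le_infI1 le_infI2 le_supI1)
  also have "inf (sup y z) (sup x y) = sup y (inf z (sup x y))"
    by (rule modular[symmetric]) simp
  also have "\<dots> = y" using z assms(2) by (simp add: inf_commute sup_absorb1 order_trans)
  finally have "sup y z = y" using assms(3) by (intro max) auto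
  then have "z \<le> y" by (metis sup_ge2)
  then have "z \<le> sup x y" by (rule le_supI2)
  then show "z \<le> a" using z by (simp add: inf_absorb2)
qed

lemma ess_below_mono:
  assumes "ess_below a b" "b \<le> c"
  shows "ess_below a c"
  using assms unfolding ess_below_def by (meson inf_mono order_refl order_trans)

section \<open>The division set generated by a basic set\<close>

text \<open>
  The lattice form of the torsion modules of a hereditary class: every nonzero quotient \<open>[x,b]\<close>
  of \<open>[a,b]\<close> contains a nonzero submodule \<open>[x,y]\<close> from the class.
\<close>

definition step_dense :: "'a::idiom set set \<Rightarrow> 'a set set" where
  "step_dense F = {{a..b} | a b. a \<le> b \<and> (\<forall>x. a \<le> x \<longrightarrow> x < b \<longrightarrow> (\<exists>y>x. y \<le> b \<and> {x..y} \<in> F))}"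

lemma Icc_in_step_dense:
  "{a..b} \<in> step_dense F \<longleftrightarrow>
    a \<le> b \<and> (\<forall>x. a \<le> x \<longrightarrow> x < b \<longrightarrow> (\<exists>y>x. y \<le> b \<and> {x..y} \<in> F))"
  for a b :: "'a::idiom"
proof
  assume "{a..b} \<in> step_dense F"
  then obtain c d where "{a..b} = {c..d}" "c \<le> d"
    and *: "\<forall>x. c \<le> x \<longrightarrow> x < d \<longrightarrow> (\<exists>y>x. y \<le> d \<and> {x..y} \<in> F)"
    unfolding step_dense_def by blast
  then have "a = c" "b = d" by (auto simp: Icc_eq_Icc)
  then show "a \<le> b \<and> (\<forall>x. a \<le> x \<longrightarrow> x < b \<longrightarrow> (\<exists>y>x. y \<le> b \<and> {x..y} \<in> F))"
    using * \<open>c \<le> d\<close> by simp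
qed (auto simp: step_dense_def)

text \<open>
  An interval of \<open>F\<close> found inside \<open>[inf x c, c]\<close> is moved up along the similarity with
  \<open>[x, sup x c]\<close>. Composition, suprema and upward similarity all reduce to this step, since they
  ask for an interval above an \<open>x\<close> that does not lie above some \<open>c\<close> already reached from \<open>a\<close>.
\<close>

lemma step_dense_step:
  assumes F: "basic_set F" and ac: "{a..c} \<in> step_dense F" and "a \<le> x" "\<not> c \<le> x"
  obtains y where "x < y" "y \<le> sup x c" "{x..y} \<in> F"
proof -
  have "a \<le> inf x c" using ac \<open>a \<le> x\<close> by (simp add: Icc_in_step_dense)
  moreover have "inf x c < c" using \<open>\<not> c \<le> x\<close> by (metis inf.cobounded1 inf.cobounded2 le_less)
  ultimately obtain y where y: "inf x c < y" "y \<le> c" "{inf x c..y} \<in> F"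
    using ac unfolding Icc_in_step_dense by blast
  have "inf x y = inf x c"
    using y by (intro antisym) (auto intro: le_infI2 less_imp_le)
  then have "{x..sup x y} \<in> F" using y(3) basic_set_up[OF F, of x y] by simp
  moreover have "x \<noteq> sup x y"
  proof
    assume "x = sup x y"
    then have "y \<le> x" by (metis sup_ge2)
    then show False using y by (metis le_inf_iff leD)
  qed
  ultimately show ?thesis
    using y(2) by (intro that[of "sup x y"]) (auto simp: less_le intro: le_supI2)
qed

text \<open>
  Given \<open>x < d \<le> b\<close>, an interval of \<open>F\<close> that starts at \<open>x\<close> may leave \<open>[x,d]\<close> at once. Starting
  it instead at a maximal relative complement of \<open>d\<close> over \<open>x\<close> forces its trace on \<open>d\<close> to be nontrivial.
\<close>

lemma step_dense_subinterval:
  assumes F: "basic_set F" and ab: "{a..b} \<in> step_dense F" and "a \<le> c" "c \<le> d" "d \<le> b"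
  shows "{c..d} \<in> step_dense F"
  unfolding Icc_in_step_dense
proof (intro conjI allI impI)
  show "c \<le> d" by fact
  fix x assume x: "c \<le> x" "x < d"
  have xb: "x \<le> b" using x \<open>d \<le> b\<close> by simp
  obtain z where z: "x \<le> z" "z \<le> b" "inf d z = x"
    and max: "\<And>w. z \<le> w \<Longrightarrow> w \<le> b \<Longrightarrow> inf d w = x \<Longrightarrow> w = z"
    using maximal_relative_complement[OF less_imp_le[OF x(2)] xb] by blast
  have "z \<noteq> b" using z(3) x(2) \<open>d \<le> b\<close> by (auto simp: inf_absorb1)
  then have "z < b" using z(2) by simp
  moreover have "a \<le> z" using \<open>a \<le> c\<close> x(1) z(1) by order
  ultimately obtain y where y: "z < y" "y \<le> b" "{z..y} \<in> F"
    using ab unfolding Icc_in_step_dense by blast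
  have "inf d y \<noteq> x" using max[OF less_imp_le[OF y(1)] y(2)] y(1) by blast
  moreover have "x \<le> inf d y" using z(1) y(1) x(2) by (simp add: less_imp_le order_trans)
  ultimately have lt: "x < inf d y" by order
  have "{z..sup z (inf d y)} \<in> F"
    using y by (intro basic_set_sub[OF F y(3)]) (auto intro: less_imp_le le_infI2)
  then have "{inf z (inf d y)..inf d y} \<in> F" by (rule basic_set_down[OF F])
  moreover have "inf z (inf d y) = x"
  proof -
    have "inf z (inf d y) = inf d (inf z y)" by (rule inf_left_commute)
    also have "inf z y = z" using y(1) by (intro inf_absorb1 less_imp_le)
    finally show ?thesis using z(3) by simp
  qed
  ultimately show "\<exists>y>x. y \<le> d \<and> {x..y} \<in> F"
    using lt by (intro exI[of _ "inf d y"]) auto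
qed

lemma step_dense_up:
  assumes F: "basic_set F" and "{inf l r..r} \<in> step_dense F"
  shows "{l..sup l r} \<in> step_dense F"
  unfolding Icc_in_step_dense
proof (intro conjI allI impI)
  fix x assume x: "l \<le> x" "x < sup l r"
  have "inf l r \<le> x" using x(1) by (rule le_infI1)
  moreover have "\<not> r \<le> x" using x by (metis le_sup_iff leD)
  ultimately obtain y where "x < y" "y \<le> sup x r" "{x..y} \<in> F"
    using step_dense_step[OF F assms(2)] by blast
  moreover have "sup x r \<le> sup l r" using x(2) by simp
  ultimately show "\<exists>y>x. y \<le> sup l r \<and> {x..y} \<in> F" by (meson order_trans)
qed simp

lemma step_dense_down:
  assumes F: "basic_set F" and D: "{l..sup l r} \<in> step_dense F"
  shows "{inf l r..r} \<in> step_dense F"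
  unfolding Icc_in_step_dense
proof (intro conjI allI impI)
  fix x assume x: "inf l r \<le> x" "x < r"
  have xr: "inf (sup l x) r = x"
    using modular[of x r l] x by (simp add: sup_commute sup_absorb1 less_imp_le)
  then have "sup l x \<noteq> sup l r" using x(2) by (auto simp: inf_absorb2)
  then have "sup l x < sup l r" using x(2) by (simp add: less_le le_supI2)
  then obtain y where y: "sup l x < y" "y \<le> sup l r" "{sup l x..y} \<in> F"
    using D unfolding Icc_in_step_dense by (meson sup_ge1)
  have yeq: "sup (sup l x) (inf r y) = y"
  proof -
    have "sup (sup l x) (inf r y) = inf (sup (sup l x) r) y"
      by (rule modular) (use y(1) in \<open>rule less_imp_le\<close>)
    also have "sup (sup l x) r = sup l r" using x(2) by (simp add: sup_assoc sup_absorb2 less_imp_le)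
    finally show ?thesis using y(2) by (simp add: inf_absorb2)
  qed
  then have "{inf (sup l x) (inf r y)..inf r y} \<in> F"
    using y(3) basic_set_down[OF F, of "sup l x" "inf r y"] by simp
  moreover have "inf (sup l x) (inf r y) = x"
  proof -
    have "inf (sup l x) (inf r y) = inf (inf (sup l x) r) y" by (simp add: inf_assoc)
    also have "\<dots> = inf x y" by (simp only: xr)
    also have "\<dots> = x" using y(1) by (intro inf_absorb1) (meson le_supE less_imp_le)
    finally show ?thesis .
  qed
  moreover have "inf r y \<noteq> x" using yeq y(1) by auto
  ultimately show "\<exists>y>x. y \<le> r \<and> {x..y} \<in> F"
    by (intro exI[of _ "inf r y"]) (metis inf.cobounded1 inf.cobounded2 le_less)
qed simp

lemma basic_set_step_dense:
  assumes F: "basic_set F"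
  shows "basic_set (step_dense F)"
  unfolding basic_set_def
proof (intro conjI ballI allI impI)
  have "{bot..bot} \<in> step_dense F" unfolding Icc_in_step_dense by auto
  then show "step_dense F \<noteq> {}" by blast
  show sub: "step_dense F \<subseteq> intervals" unfolding step_dense_def intervals_def by blast
  show "J \<in> step_dense F" if "I \<in> step_dense F" "similar I J" for I J
    using that step_dense_up[OF F] step_dense_down[OF F] unfolding similar_def by auto
  show "J \<in> step_dense F" if I_in: "I \<in> step_dense F" and J_in: "J \<in> intervals" and "J \<subseteq> I" for I J
  proof -
    obtain a b where "I = {a..b}" using I_in sub unfolding intervals_def by blast
    moreover obtain c d where "J = {c..d}" "c \<le> d" using J_in unfolding intervals_def by blast
    ultimately show ?thesis using I_in \<open>J \<subseteq> I\<close> step_dense_subinterval[OF F, of a b c d] by auto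
  qed
qed

lemma division_set_step_dense:
  assumes F: "basic_set F"
  shows "division_set (step_dense F)"
  unfolding division_set_def
proof (intro conjI allI impI)
  show "basic_set (step_dense F)" using F by (rule basic_set_step_dense)
  show "{a..c} \<in> step_dense F" if ab: "{a..b} \<in> step_dense F" and bc: "{b..c} \<in> step_dense F" for a b c
    unfolding Icc_in_step_dense
  proof (intro conjI allI impI)
    have le: "a \<le> b" "b \<le> c" using ab bc by (simp_all add: Icc_in_step_dense)
    then show "a \<le> c" by order
    fix x assume x: "a \<le> x" "x < c"
    show "\<exists>y>x. y \<le> c \<and> {x..y} \<in> F"
    proof (cases "b \<le> x")
      case True
      then show ?thesis using bc x(2) by (simp add: Icc_in_step_dense)
    next
      case False
      then obtain y where "x < y" "y \<le> sup x b" "{x..y} \<in> F"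
        using step_dense_step[OF F ab x(1)] by blast
      moreover have "sup x b \<le> c" using x(2) le(2) by simp
      ultimately show ?thesis by (meson order_trans)
    qed
  qed
  show "{a..Sup X} \<in> step_dense F"
    if X: "X \<noteq> {}" "X \<subseteq> {a..top}" "\<forall>x\<in>X. {a..x} \<in> step_dense F" for a X
    unfolding Icc_in_step_dense
  proof (intro conjI allI impI)
    obtain x where "x \<in> X" using X(1) by blast
    moreover from this have "a \<le> x" using X(2) by auto
    ultimately show "a \<le> Sup X" by (rule Sup_upper2)
    fix x assume x: "a \<le> x" "x < Sup X"
    then obtain c where c: "c \<in> X" "\<not> c \<le> x" by (metis Sup_least leD)
    then obtain y where "x < y" "y \<le> sup x c" "{x..y} \<in> F"
      using step_dense_step[OF F bspec[OF X(3) c(1)] x(1)] by blast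
    moreover have "sup x c \<le> Sup X" using x(2) c(1) by (simp add: Sup_upper)
    ultimately show "\<exists>y>x. y \<le> Sup X \<and> {x..y} \<in> F" by (meson order_trans)
  qed
qed

lemma Dvs_subset_step_dense:
  assumes F: "basic_set F"
  shows "Dvs F \<subseteq> step_dense F"
proof (rule Dvs_least(2)[OF division_set_step_dense[OF F]], rule subsetI)
  fix I assume I: "I \<in> F"
  then obtain a b where ab: "I = {a..b}" "a \<le> b"
    using basic_setD(2)[OF F] unfolding intervals_def by blast
  have "{x..b} \<in> F" if "a \<le> x" "x < b" for x
    using basic_set_sub[OF F, of a b x b] I ab that by simp
  then show "I \<in> step_dense F" using ab by (auto simp: Icc_in_step_dense)
qed

lemma fixed_by_nuc_of_Dvs:
  assumes F: "basic_set F" and c: "\<And>y. c \<le> y \<Longrightarrow> {c..y} \<in> F \<Longrightarrow> y = c"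
  shows "c \<in> fixpoints (nuc_of_div (Dvs F))"
proof -
  let ?j = "nuc_of_div (Dvs F)"
  have D: "division_set (Dvs F)" by (intro division_set_Dvs basic_setD(2)[OF F])
  have "{c..?j c} \<in> step_dense F"
    using nuc_of_div_Icc(2)[OF D] Dvs_subset_step_dense[OF F] by blast
  then have "\<not> c < ?j c" using c unfolding Icc_in_step_dense by (metis less_le order_refl)
  then show ?thesis using nuc_of_div_Icc(1)[OF D, of c] by (simp add: fixpoints_def less_le)
qed

section \<open>Nuclei and their fixed sets\<close>

lemma Icc_in_div_of_nuc:
  assumes "a \<le> b"
  shows "{a..b} \<in> div_of_nuc k \<longleftrightarrow> b \<le> k a"
  using assms unfolding div_of_nuc_def by (auto simp: Icc_eq_Icc)

lemma basic_set_div_of_nuc: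
  assumes k: "nucleus k"
  shows "basic_set (div_of_nuc k)"
  unfolding basic_set_def
proof (intro conjI ballI allI impI)
  have "{top..top} \<in> div_of_nuc k" using nucleusD(2)[OF k] by (simp only: Icc_in_div_of_nuc order_refl)
  then show "div_of_nuc k \<noteq> {}" by blast
  show "div_of_nuc k \<subseteq> intervals" unfolding div_of_nuc_def intervals_def by blast
  have up: "{l..sup l r} \<in> div_of_nuc k" if "{inf l r..r} \<in> div_of_nuc k" for l r
  proof -
    have "r \<le> k (inf l r)" using that by (simp add: Icc_in_div_of_nuc)
    also have "\<dots> \<le> k l" by (intro nucleusD(1)[OF k]) simp
    finally show ?thesis using nucleusD(2)[OF k] by (simp add: Icc_in_div_of_nuc)
  qed
  have down: "{inf l r..r} \<in> div_of_nuc k" if "{l..sup l r} \<in> div_of_nuc k" for l r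
    using that nucleusD(2,3)[OF k] by (simp add: Icc_in_div_of_nuc)
  show "J \<in> div_of_nuc k" if "I \<in> div_of_nuc k" "similar I J" for I J
    using that up down unfolding similar_def by auto
  show "J \<in> div_of_nuc k" if I_in: "I \<in> div_of_nuc k" and J_in: "J \<in> intervals" and "J \<subseteq> I" for I J
  proof -
    obtain a b where I: "I = {a..b}" "a \<le> b" "b \<le> k a"
      using I_in unfolding div_of_nuc_def by blast
    obtain c d where J: "J = {c..d}" "c \<le> d" using J_in unfolding intervals_def by blast
    then have "a \<le> c" "d \<le> b" using I \<open>J \<subseteq> I\<close> by auto
    then have "d \<le> k c" using I(3) nucleusD(1)[OF k, of a c] by (meson order_trans)
    then show ?thesis using J by (simp add: Icc_in_div_of_nuc)
  qed
qed

lemma Inf_in_fixpoints: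
  assumes k: "nucleus k" and X: "X \<subseteq> fixpoints k"
  shows "Inf X \<in> fixpoints k"
proof -
  have "k (Inf X) \<le> x" if "x \<in> X" for x
    using nucleusD(1)[OF k Inf_lower[OF that]] X that by (auto simp: fixpoints_def)
  then have "k (Inf X) \<le> Inf X" by (rule Inf_greatest)
  then show ?thesis using nucleusD(2)[OF k, of "Inf X"] by (simp add: fixpoints_def)
qed

lemma fixpoints_antimono:
  assumes "nucleus j" "j \<le> k"
  shows "fixpoints k \<subseteq> fixpoints j"
  using assms nucleusD(2)[OF assms(1)] unfolding fixpoints_def le_fun_def
  by (metis (mono_tags, lifting) CollectD CollectI antisym subsetI)

lemma nucleus_le_if_fixpoints:
  assumes "nucleus j" "nucleus k" "fixpoints k \<subseteq> fixpoints j"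
  shows "j \<le> k"
proof (rule le_funI)
  fix a
  have "k a \<in> fixpoints j" using assms nucleusD(4)[OF assms(2)] by (auto simp: fixpoints_def)
  then show "j a \<le> k a"
    using nucleusD(1)[OF assms(1) nucleusD(2)[OF assms(2), of a]] by (simp add: fixpoints_def)
qed

lemma fixpoints_inject:
  assumes "nucleus j" "nucleus k"
  shows "fixpoints j = fixpoints k \<longleftrightarrow> j = k"
  using nucleus_le_if_fixpoints assms by (metis antisym order_refl)

lemma top_in_fixpoints: "nucleus k \<Longrightarrow> top \<in> fixpoints k"
  using nucleusD(2)[of k top] by (simp add: fixpoints_def top_unique)

lemma nucleus_tp: "nucleus tp"
  unfolding nucleus_def tp_def by (auto simp: monoI)

text \<open>
  The supremum of nuclei is not pointwise, but its division set is generated by the union of the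
  division sets, and that union is a basic set.
\<close>

lemma fixed_by_nuclei_Sup:
  assumes "J \<noteq> {}" and J: "\<And>k. k \<in> J \<Longrightarrow> nucleus k \<and> c \<in> fixpoints k"
  shows "c \<in> fixpoints (nuclei_Sup J)"
proof -
  let ?F = "\<Union>k\<in>J. div_of_nuc k"
  have B: "basic_set (div_of_nuc k)" if "k \<in> J" for k
    using J[OF that] basic_set_div_of_nuc by blast
  have F: "basic_set ?F"
    unfolding basic_set_def
  proof (intro conjI ballI allI impI)
    show "?F \<noteq> {}" using \<open>J \<noteq> {}\<close> B basic_setD(1) by blast
    show "?F \<subseteq> intervals" using B basic_setD(2) by blast
    show "N \<in> ?F" if "M \<in> ?F" "similar M N" for M N
      using that B basic_setD(3) by blast
    show "N \<in> ?F" if "M \<in> ?F" "N \<in> intervals" "N \<subseteq> M" for M N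
      using that B basic_setD(4) by (metis UN_iff)
  qed
  have D: "division_set (Dvs ?F)" by (intro division_set_Dvs basic_setD(2)[OF F])
  have "c \<in> fixpoints (nuc_of_div (Dvs ?F))"
  proof (rule fixed_by_nuc_of_Dvs[OF F])
    fix y assume y: "c \<le> y" "{c..y} \<in> ?F"
    then obtain k where k: "k \<in> J" "{c..y} \<in> div_of_nuc k" by blast
    then have "y \<le> k c" using y(1) by (simp add: Icc_in_div_of_nuc)
    also have "k c = c" using J[OF k(1)] by (simp add: fixpoints_def)
    finally show "y = c" using y(1) by simp
  qed
  moreover have "nuclei_Sup J \<le> nuc_of_div (Dvs ?F)"
  proof (rule nuclei_Sup_is_lub(3)[OF nucleus_nuc_of_div[OF D]], rule le_funI)
    fix k a assume k: "k \<in> J"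
    have le: "a \<le> k a" using J[OF k] nucleusD(2) by blast
    then have "{a..k a} \<in> div_of_nuc k" by (simp add: Icc_in_div_of_nuc)
    then have "{a..k a} \<in> Dvs ?F" using k Dvs_least(1) by blast
    then show "k a \<le> nuc_of_div (Dvs ?F) a" using nuc_of_div_Icc(3)[OF D le] by simp
  qed
  ultimately show ?thesis using fixpoints_antimono[OF nuclei_Sup_is_lub(1)] by blast
qed

section \<open>Full intervals and cohesive sets\<close>

lemma Icc_in_Fll:
  assumes "a \<le> b"
  shows "{a..b} \<in> Fll B \<longleftrightarrow> (\<forall>x\<in>{a..b}. \<exists>y\<in>{a..b}. inf x y = a \<and> {sup x y..b} \<in> B)"
proof
  assume "{a..b} \<in> Fll B"
  then obtain c d where "{a..b} = {c..d}"
    and *: "\<forall>x\<in>{c..d}. \<exists>y\<in>{c..d}. inf x y = c \<and> {sup x y..d} \<in> B"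
    unfolding Fll_def by blast
  then have "a = c" "b = d" using assms by (auto simp: Icc_eq_Icc)
  then show "\<forall>x\<in>{a..b}. \<exists>y\<in>{a..b}. inf x y = a \<and> {sup x y..b} \<in> B" using * by simp
qed (use assms in \<open>auto simp: Fll_def\<close>)

text \<open>The relative complement \<open>y\<close> of \<open>x\<close> in \<open>[a,b]\<close> is cut down to \<open>[c,d]\<close> as \<open>sup c (inf y d)\<close>.\<close>

lemma Fll_subinterval:
  assumes B: "basic_set B" and ab: "{a..b} \<in> Fll B" and le: "a \<le> c" "c \<le> d" "d \<le> b"
  shows "{c..d} \<in> Fll B"
  unfolding Icc_in_Fll[OF le(2)]
proof
  fix x assume x: "x \<in> {c..d}"
  have "a \<le> b" using le by order
  moreover have "x \<in> {a..b}" using x le by (auto intro: order_trans)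
  ultimately obtain y where y: "y \<in> {a..b}" "inf x y = a" "{sup x y..b} \<in> B"
    using ab Icc_in_Fll by blast
  let ?y = "sup c (inf y d)"
  have "inf x ?y = c"
  proof -
    have "inf x ?y = inf (sup c (inf y d)) x" by (rule inf_commute)
    also have "\<dots> = sup c (inf (inf y d) x)" using x by (intro modular[symmetric]) simp
    also have "inf (inf y d) x = a"
      using y x le by (metis atLeastAtMost_iff inf.absorb2 inf_assoc inf_commute)
    finally show ?thesis using le(1) by (simp add: sup_absorb1)
  qed
  moreover have "{sup x ?y..d} \<in> B"
  proof -
    have "{sup x y..sup (sup x y) d} \<in> B"
      by (rule basic_set_sub[OF B y(3)]) (use y(1) \<open>x \<in> {a..b}\<close> le(3) in auto)
    then have "{inf (sup x y) d..d} \<in> B" by (rule basic_set_down[OF B])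
    moreover have "sup x ?y = sup x (inf y d)"
      using x by (simp add: sup_assoc[symmetric] sup_absorb1)
    moreover have "\<dots> = inf (sup x y) d" using x by (intro modular) simp
    ultimately show ?thesis by simp
  qed
  ultimately show "\<exists>y\<in>{c..d}. inf x y = c \<and> {sup x y..d} \<in> B"
    using le(2) by (intro bexI[of _ ?y]) (auto simp: le_infI2)
qed

lemma Fll_down:
  assumes B: "basic_set B" and full: "{l..sup l r} \<in> Fll B"
  shows "{inf l r..r} \<in> Fll B"
  unfolding Icc_in_Fll[OF inf_le2]
proof
  fix x assume x: "x \<in> {inf l r..r}"
  have "sup x l \<in> {l..sup l r}" using x by (auto intro: le_supI2)
  then obtain y where y: "y \<in> {l..sup l r}" "inf (sup x l) y = l" "{sup (sup x l) y..sup l r} \<in> B"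
    using full Icc_in_Fll[OF sup_ge1] by blast
  have sy: "sup (sup x l) y = sup x y" using y(1) by (simp add: sup_assoc sup_absorb2)
  have "inf x (inf y r) = inf l r"
  proof (rule antisym)
    have "inf x (inf y r) \<le> inf (sup x l) y" by (auto intro: le_infI1 le_supI1 le_infI2)
    then show "inf x (inf y r) \<le> inf l r" using y(2) by (simp add: le_infI2)
    show "inf l r \<le> inf x (inf y r)" using x y(1) by (auto intro: le_infI1)
  qed
  moreover have "{sup x (inf y r)..r} \<in> B"
  proof -
    have "sup (sup x y) r = sup l r"
      using x y(1) by (intro antisym) (auto intro: le_supI1 le_supI2)
    then have "{inf (sup x y) r..r} \<in> B"
      using y(3) sy basic_set_down[OF B, of "sup x y" r] by simp
    moreover have "sup x (inf y r) = inf (sup x y) r" using x by (intro modular) simp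
    ultimately show ?thesis by simp
  qed
  ultimately show "\<exists>y\<in>{inf l r..r}. inf x y = inf l r \<and> {sup x y..r} \<in> B"
    using y(1) by (intro bexI[of _ "inf y r"]) (auto intro: le_infI1)
qed

lemma Fll_up:
  assumes B: "basic_set B" and full: "{inf l r..r} \<in> Fll B"
  shows "{l..sup l r} \<in> Fll B"
  unfolding Icc_in_Fll[OF sup_ge1]
proof
  fix x assume x: "x \<in> {l..sup l r}"
  have "inf x r \<in> {inf l r..r}" using x by (auto intro: le_infI1)
  then obtain y where y: "y \<in> {inf l r..r}" "inf (inf x r) y = inf l r" "{sup (inf x r) y..r} \<in> B"
    using full Icc_in_Fll[OF inf_le2] by blast
  have xy: "inf y x = inf l r"
    using y(1,2) by (metis atLeastAtMost_iff inf.absorb2 inf_assoc inf_commute)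
  have "inf x (sup l y) = l"
  proof -
    have "inf x (sup l y) = inf (sup l y) x" by (rule inf_commute)
    also have "\<dots> = sup l (inf y x)" using x by (intro modular[symmetric]) simp
    finally show ?thesis by (simp add: xy sup_absorb1)
  qed
  moreover have "{sup x (sup l y)..sup l r} \<in> B"
  proof -
    have "inf (sup x y) r = sup (inf x r) y"
      using modular[of y r x] y(1) by (simp add: sup_commute)
    then have "{sup x y..sup (sup x y) r} \<in> B"
      using y(3) basic_set_up[OF B, of "sup x y" r] by simp
    moreover have "sup (sup x y) r = sup l r"
      using x y(1) by (intro antisym) (auto intro: le_supI1 le_supI2)
    moreover have "sup x (sup l y) = sup x y" using x by (simp add: sup_assoc[symmetric] sup_absorb1)
    ultimately show ?thesis by simp
  qed
  ultimately show "\<exists>y\<in>{l..sup l r}. inf x y = l \<and> {sup x y..sup l r} \<in> B"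
    using y(1) by (intro bexI[of _ "sup l y"]) (auto intro: le_supI2)
qed

lemma basic_set_Fll:
  assumes B: "basic_set B"
  shows "basic_set (Fll B)"
  unfolding basic_set_def
proof (intro conjI ballI allI impI)
  have "{bot..bot} \<in> Fll B"
    using basic_set_trivial[OF B, of bot] by (simp only: Icc_in_Fll order_refl) simp
  then show "Fll B \<noteq> {}" by blast
  show "Fll B \<subseteq> intervals" by (rule Fll_subset)
  show "J \<in> Fll B" if "I \<in> Fll B" "similar I J" for I J
    using that Fll_up[OF B] Fll_down[OF B] unfolding similar_def by auto
  show "J \<in> Fll B" if I_in: "I \<in> Fll B" and J_in: "J \<in> intervals" and "J \<subseteq> I" for I J
  proof -
    obtain a b where "I = {a..b}" using I_in Fll_subset unfolding intervals_def by blast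
    moreover obtain c d where "J = {c..d}" "c \<le> d" using J_in unfolding intervals_def by blast
    ultimately show ?thesis using I_in \<open>J \<subseteq> I\<close> Fll_subinterval[OF B, of a b c d] by auto
  qed
qed

text \<open>
  Fullness supplies a relative complement of \<open>inf x y\<close> in \<open>[c,y]\<close>, where \<open>c\<close> is essential below
  \<open>x\<close>; essentiality forces that complement to be \<open>c\<close> itself.
\<close>

lemma full_interval_bounded_by_essential:
  assumes k: "nucleus k" and "c \<le> y" and full: "{c..y} \<in> Fll (div_of_nuc k)"
    and x: "ess_below c x" "x \<in> fixpoints k"
  shows "y \<le> x"
proof -
  have "inf x y \<in> {c..y}" using x(1) \<open>c \<le> y\<close> by (simp add: ess_below_def)
  then obtain z where z: "z \<in> {c..y}" "inf (inf x y) z = c" "{sup (inf x y) z..y} \<in> div_of_nuc k"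
    using full Icc_in_Fll[OF \<open>c \<le> y\<close>] by blast
  have "inf x z = c" using z(1,2) by (simp add: inf_assoc inf_absorb2)
  then have "z \<le> c" using x(1) by (simp add: ess_below_def)
  moreover have "c \<le> inf x y" using x(1) \<open>c \<le> y\<close> by (simp add: ess_below_def)
  ultimately have "sup (inf x y) z = inf x y" by (intro sup_absorb1) (rule order_trans)
  then have "y \<le> k (inf x y)" using z(3) by (simp add: Icc_in_div_of_nuc)
  also have "\<dots> \<le> k x" by (intro nucleusD(1)[OF k]) simp
  finally show ?thesis using x(2) by (simp add: fixpoints_def)
qed

lemma cohesive_fixed_by_Boy:
  assumes k: "nucleus k" and K: "cohesive K" "K \<subseteq> fixpoints k"
  shows "K \<subseteq> fixpoints (Boy k)"
proof
  fix c assume "c \<in> K"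
  then obtain X where X: "X \<subseteq> K" "c = Inf X" "\<forall>x\<in>X. ess_below c x"
    using K(1) unfolding cohesive_def by blast
  show "c \<in> fixpoints (Boy k)"
    unfolding Boy_def
  proof (rule fixed_by_nuc_of_Dvs[OF basic_set_Fll[OF basic_set_div_of_nuc[OF k]]])
    fix y assume y: "c \<le> y" "{c..y} \<in> Fll (div_of_nuc k)"
    have "y \<le> x" if "x \<in> X" for x
      using full_interval_bounded_by_essential[OF k y] X(1,3) K(2) that by blast
    then have "y \<le> c" unfolding X(2) by (rule Inf_greatest)
    then show "y = c" using y(1) by simp
  qed
qed

lemma cohesive_fixpoints_of_Boy_fixed:
  assumes k: "nucleus k" and fixed: "Boy k = k"
  shows "cohesive (fixpoints k)"
  unfolding cohesive_def
proof (intro conjI ballI)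
  show "fixpoints k \<noteq> {}" using top_in_fixpoints[OF k] by blast
  fix a assume a: "a \<in> fixpoints k"
  define X where "X = {x \<in> fixpoints k. ess_below a x}"
  define b where "b = Inf X"
  have "a \<le> b" unfolding b_def X_def by (auto simp: ess_below_def intro: Inf_greatest)
  have kb: "k b = b"
    using Inf_in_fixpoints[OF k, of X] by (auto simp: b_def X_def fixpoints_def)
  have "{a..b} \<in> Fll (div_of_nuc k)"
    unfolding Icc_in_Fll[OF \<open>a \<le> b\<close>]
  proof
    fix x assume x: "x \<in> {a..b}"
    then have "a \<le> x" by simp
    then obtain y where y: "a \<le> y" "inf x y = a"
      and max: "\<And>z. y \<le> z \<Longrightarrow> inf x z = a \<Longrightarrow> z = y"
      using maximal_relative_complement[of a x top] by (metis top_greatest)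
    have "ess_below a (k (sup x y))"
      by (rule ess_below_mono[OF ess_below_sup_maximal_complement nucleusD(2)[OF k]])
        (use \<open>a \<le> x\<close> y max in auto)
    then have "k (sup x y) \<in> X" using nucleusD(4)[OF k] by (simp add: X_def fixpoints_def)
    then have "b \<le> k (sup x y)" unfolding b_def by (rule Inf_lower)
    then have "b \<le> k (inf (sup x y) b)" by (simp add: nucleusD(3)[OF k] kb)
    also have "inf (sup x y) b = sup x (inf y b)" using x by (intro modular[symmetric]) simp
    finally have "{sup x (inf y b)..b} \<in> div_of_nuc k" using x by (simp add: Icc_in_div_of_nuc)
    moreover have "inf x (inf y b) = a"
      using y(2) \<open>a \<le> b\<close> by (simp add: inf_assoc[symmetric] inf_absorb1)
    ultimately show "\<exists>y\<in>{a..b}. inf x y = a \<and> {sup x y..b} \<in> div_of_nuc k"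
      using y(1) \<open>a \<le> b\<close> by (intro bexI[of _ "inf y b"]) auto
  qed
  then have "{a..b} \<in> div_of_nuc k" using Dvs_least(1) div_of_Boy[of k] fixed by auto
  then have "b \<le> a" using a \<open>a \<le> b\<close> by (simp add: Icc_in_div_of_nuc fixpoints_def)
  then have "a = Inf X" using \<open>a \<le> b\<close> unfolding b_def by (rule antisym[rotated])
  then show "\<exists>X\<subseteq>fixpoints k. a = Inf X \<and> (\<forall>x\<in>X. ess_below a x)"
    by (intro exI[of _ X]) (auto simp: X_def)
qed

section \<open>The stable derivative\<close>

lemma Boy_infty_induct:
  fixes j :: "'a::idiom \<Rightarrow> 'a"
  assumes j: "nucleus j" and P0: "P j"
    and P_Boy: "\<And>k. nucleus k \<Longrightarrow> P k \<Longrightarrow> P (Boy k)"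
    and P_Sup: "\<And>J. J \<noteq> {} \<Longrightarrow> (\<And>k. k \<in> J \<Longrightarrow> nucleus k \<and> P k) \<Longrightarrow> P (nuclei_Sup J)"
  shows "P (Boy_infty j)"
proof -
  let ?r = "long_order :: ('a \<Rightarrow> 'a) set rel"
  have r: "Well_order ?r" by (rule card_of_Well_order)
  interpret wo: wo_rel ?r using r by (simp add: wo_rel_def)
  have "P (Boy_iter ?r j \<alpha>)" for \<alpha>
  proof (induction \<alpha> rule: wo.well_order_induct)
    case (1 \<alpha>)
    then have IH: "P (Boy_iter ?r j \<beta>)" if "\<beta> \<in> underS ?r \<alpha>" for \<beta>
      using that unfolding underS_def by blast
    consider "underS ?r \<alpha> = {}" | \<beta> where "is_succ_of ?r \<alpha> \<beta>"
      | "underS ?r \<alpha> \<noteq> {}" "\<nexists>\<beta>. is_succ_of ?r \<alpha> \<beta>" by blast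
    then show ?case
    proof cases
      case 1
      then show ?thesis using P0 by (simp only: Boy_iter_zero[OF r])
    next
      case (2 \<beta>)
      then have "\<beta> \<in> underS ?r \<alpha>" by (simp add: is_succ_of_def)
      then show ?thesis
        unfolding Boy_iter_succ[OF r 2] by (intro P_Boy nucleus_Boy_iter[OF r j] IH)
    next
      case 3
      show ?thesis
        unfolding Boy_iter_lim[OF r 3]
        by (rule P_Sup) (use 3(1) IH nucleus_Boy_iter[OF r j] in auto)
    qed
  qed
  then show ?thesis using Boy_infty_stable(1)[OF j] by auto
qed

lemma nucleus_Boy_infty:
  assumes "nucleus j"
  shows "nucleus (Boy_infty j)"
  using assms by (rule Boy_infty_induct) (use assms nucleus_Boy nuclei_Sup_is_lub(1) in auto)

lemma Boy_infty_ge: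
  assumes "nucleus j"
  shows "j \<le> Boy_infty j"
  using assms
proof (rule Boy_infty_induct)
  show "j \<le> Boy k" if "nucleus k" "j \<le> k" for k
    using that(2) Boy_ge[OF that(1)] by (rule order_trans)
  fix J :: "('a \<Rightarrow> 'a) set"
  assume "J \<noteq> {}" "\<And>k. k \<in> J \<Longrightarrow> nucleus k \<and> j \<le> k"
  then obtain k where "k \<in> J" "j \<le> k" by blast
  then show "j \<le> nuclei_Sup J" using nuclei_Sup_is_lub(2) by (blast intro: order_trans)
qed simp

lemma cohesive_fixed_by_Boy_infty:
  assumes "nucleus j" and K: "cohesive_in j K"
  shows "K \<subseteq> fixpoints (Boy_infty j)"
  using assms(1)
proof (rule Boy_infty_induct)
  show "K \<subseteq> fixpoints j" using K by (simp add: cohesive_in_def)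
  show "K \<subseteq> fixpoints (Boy k)" if "nucleus k" "K \<subseteq> fixpoints k" for k
    using that K by (intro cohesive_fixed_by_Boy) (simp_all add: cohesive_in_def)
  show "K \<subseteq> fixpoints (nuclei_Sup J)"
    if "J \<noteq> {}" "\<And>k. k \<in> J \<Longrightarrow> nucleus k \<and> K \<subseteq> fixpoints k" for J
    using that fixed_by_nuclei_Sup[of J] by blast
qed

lemma cohesive_in_top:
  assumes "nucleus j"
  shows "cohesive_in j {top}"
  unfolding cohesive_in_def cohesive_def
  \<comment> \<open>The empty family serves, as its meet is \<open>top\<close>.\<close>
  using top_in_fixpoints[OF assms] by (auto intro: exI[of _ "{}"])

theorem theorem3p13:
  fixes j :: "'a::idiom \<Rightarrow> 'a"
  assumes "nucleus j"
  shows "(Boy_infty j = tp \<longleftrightarrow> {K. cohesive_in j K} = {{top}})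
    \<and> (cohesive_in j (fixpoints (Boy_infty j))
        \<and> (\<forall>K. cohesive_in j K \<longrightarrow> K \<subseteq> fixpoints (Boy_infty j)))
    \<and> (Boy_infty j = j \<longleftrightarrow> cohesive (fixpoints j))"
proof -
  let ?B = "Boy_infty j"
  have nB: "nucleus ?B" using assms by (rule nucleus_Boy_infty)
  have sub: "fixpoints ?B \<subseteq> fixpoints j"
    by (rule fixpoints_antimono[OF assms Boy_infty_ge[OF assms]])
  have coh: "cohesive (fixpoints ?B)"
    by (rule cohesive_fixpoints_of_Boy_fixed[OF nB Boy_infty_stable(2)[OF assms]])
  have in_j: "cohesive_in j (fixpoints ?B)" using coh sub by (simp add: cohesive_in_def)
  have biggest: "K \<subseteq> fixpoints ?B" if "cohesive_in j K" for K
    using assms that by (rule cohesive_fixed_by_Boy_infty)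
  have tp: "?B = tp \<longleftrightarrow> fixpoints ?B = {top}"
  proof -
    have "fixpoints (tp :: 'a \<Rightarrow> 'a) = {top}" by (auto simp: fixpoints_def tp_def)
    then show ?thesis using fixpoints_inject[OF nB nucleus_tp] by simp
  qed
  have "?B = tp \<longleftrightarrow> {K. cohesive_in j K} = {{top}}"
    unfolding tp
  proof
    assume "fixpoints ?B = {top}"
    then have "K = {top}" if "cohesive_in j K" for K
      using biggest[OF that] that by (auto simp: cohesive_in_def cohesive_def)
    then show "{K. cohesive_in j K} = {{top}}" using cohesive_in_top[OF assms] by blast
  qed (use in_j in blast)
  moreover have "?B = j \<longleftrightarrow> cohesive (fixpoints j)"
  proof
    assume "cohesive (fixpoints j)"
    then have "fixpoints j \<subseteq> fixpoints ?B" by (intro biggest) (simp add: cohesive_in_def)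
    then show "?B = j" using sub fixpoints_inject[OF nB assms] by blast
  qed (use coh in simp)
  ultimately show ?thesis using in_j biggest by blast
qed

end
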